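(* For a Banach lattice $E$ the following assertions are equivalent: (1) The norm of $E$ is order continuous. (2) For each Banach space $X$, every strong order bounded operator $T : X \to E$ is L-weakly compact. (3) Every strong order bounded operator $T : \ell_1 \to E$ is L-weakly compact.
   Context: All Banach spaces and Banach lattices are real; "operator" means bounded linear map; $B_X$ is the closed unit ball of $X$. An operator $T$ from a Banach space $X$ into a Banach lattice $F$ is strong order bounded if it maps the unit ball $B_X$ into an order bounded subset of $F$. A nonempty bounded subset $A$ of a Banach lattice is L-weakly compact if $\lim\|x_n\|=0$ for every disjoint sequence $(x_n)$ in the solid hull of $A$. An operator $T$ from a Banach space $X$ into a Banach lattice $F$ is L-weakly compact if $T(B_X)$ is an L-weakly compact subset of $F$. *)

theory Defs
  imports "HOL-Analysis.Analysis" "HOL-Library.Lattice_Algebras"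
begin

section \<open>Banach lattices\<close>

(* Lattice_Algebras supplies \<bar>x\<bar> = sup x (- x). *)
class banach_lattice = banach + ordered_real_vector + lattice_ab_group_add_abs +
  assumes norm_le_if_abs_le: "\<bar>x\<bar> \<le> \<bar>y\<bar> \<Longrightarrow> norm x \<le> norm y"

definition solid :: "'e::banach_lattice set \<Rightarrow> bool" where
  "solid S \<longleftrightarrow> (\<forall>x y. y \<in> S \<and> \<bar>x\<bar> \<le> \<bar>y\<bar> \<longrightarrow> x \<in> S)"

definition order_bounded :: "'e::banach_lattice set \<Rightarrow> bool" where
  "order_bounded A \<longleftrightarrow> (\<exists>a b. A \<subseteq> {a..b})"

definition disjoint_sequence :: "(nat \<Rightarrow> 'e::banach_lattice) \<Rightarrow> bool" where
  "disjoint_sequence x \<longleftrightarrow> (\<forall>m n. m \<noteq> n \<longrightarrow> inf \<bar>x m\<bar> \<bar>x n\<bar> = 0)"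

definition L_weakly_compact :: "'e::banach_lattice set \<Rightarrow> bool" where
  "L_weakly_compact A \<longleftrightarrow> A \<noteq> {} \<and> bounded A \<and>
     (\<forall>x. disjoint_sequence x \<and> range x \<subseteq> solid hull A \<longrightarrow> (\<lambda>n. norm (x n)) \<longlonglongrightarrow> 0)"

(* D decreases to 0: D is a nonempty downward directed set with greatest lower bound 0. *)
definition decreases_to_zero :: "'e::banach_lattice set \<Rightarrow> bool" where
  "decreases_to_zero D \<longleftrightarrow> D \<noteq> {} \<and> (\<forall>x\<in>D. \<forall>y\<in>D. \<exists>z\<in>D. z \<le> x \<and> z \<le> y) \<and>
     (\<forall>x\<in>D. 0 \<le> x) \<and> (\<forall>l. (\<forall>x\<in>D. l \<le> x) \<longrightarrow> l \<le> 0)"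

(* The norm is order continuous if the norms of every net decreasing to 0 tend to 0.
   HOL cannot quantify over the index sets of nets.  A decreasing net is therefore given by
   its range D, a downward directed set indexed by itself; the filter below is the
   filter of tails of this net. *)
definition order_continuous_norm :: "'e::banach_lattice itself \<Rightarrow> bool" where
  "order_continuous_norm _ \<longleftrightarrow>
     (\<forall>D :: 'e set. decreases_to_zero D \<longrightarrow>
        (norm \<longlongrightarrow> 0) (INF d\<in>D. principal {x \<in> D. x \<le> d}))"


section \<open>Banach spaces as first-class objects\<close>

(* HOL cannot quantify over types inside a formula, so a Banach space that is to be quantified
   over is a structure on a carrier set instead of an instance of class banach.  The type 'x
   only bounds the size of the spaces considered: a Banach space of any size has an isometric
   copy on a subset of every type that is large enough. *)
record 'x normed_structure =
  vcarrier :: "'x set"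
  vzero :: 'x
  vadd :: "'x \<Rightarrow> 'x \<Rightarrow> 'x"
  vscale :: "real \<Rightarrow> 'x \<Rightarrow> 'x"
  vnorm :: "'x \<Rightarrow> real"

(* Metric_space requires a nonnegative symmetric distance on the whole type, hence the value 0
   outside the carrier. *)
definition vdist :: "'x normed_structure \<Rightarrow> 'x \<Rightarrow> 'x \<Rightarrow> real" where
  "vdist X x y = (if x \<in> vcarrier X \<and> y \<in> vcarrier X
     then vnorm X (vadd X x (vscale X (- 1) y)) else 0)"

locale real_vector_space_on =
  fixes X :: "'x normed_structure"
  assumes zero_closed: "vzero X \<in> vcarrier X"
    and add_closed: "\<lbrakk>x \<in> vcarrier X; y \<in> vcarrier X\<rbrakk> \<Longrightarrow> vadd X x y \<in> vcarrier X"
    and scale_closed: "x \<in> vcarrier X \<Longrightarrow> vscale X c x \<in> vcarrier X"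
    and add_assoc: "\<lbrakk>x \<in> vcarrier X; y \<in> vcarrier X; z \<in> vcarrier X\<rbrakk>
          \<Longrightarrow> vadd X (vadd X x y) z = vadd X x (vadd X y z)"
    and add_commute: "\<lbrakk>x \<in> vcarrier X; y \<in> vcarrier X\<rbrakk> \<Longrightarrow> vadd X x y = vadd X y x"
    and add_zero: "x \<in> vcarrier X \<Longrightarrow> vadd X (vzero X) x = x"
    and add_inverse: "x \<in> vcarrier X \<Longrightarrow> \<exists>y \<in> vcarrier X. vadd X x y = vzero X"
    and scale_add_right: "\<lbrakk>x \<in> vcarrier X; y \<in> vcarrier X\<rbrakk>
          \<Longrightarrow> vscale X c (vadd X x y) = vadd X (vscale X c x) (vscale X c y)"
    and scale_add_left: "x \<in> vcarrier X
          \<Longrightarrow> vscale X (c + d) x = vadd X (vscale X c x) (vscale X d x)"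
    and scale_scale: "x \<in> vcarrier X \<Longrightarrow> vscale X c (vscale X d x) = vscale X (c * d) x"
    and scale_one: "x \<in> vcarrier X \<Longrightarrow> vscale X 1 x = x"

locale banach_space_on = real_vector_space_on X for X :: "'x normed_structure" +
  assumes norm_eq_zero: "x \<in> vcarrier X \<Longrightarrow> vnorm X x = 0 \<longleftrightarrow> x = vzero X"
    and norm_triangle: "\<lbrakk>x \<in> vcarrier X; y \<in> vcarrier X\<rbrakk>
          \<Longrightarrow> vnorm X (vadd X x y) \<le> vnorm X x + vnorm X y"
    and norm_scale: "x \<in> vcarrier X \<Longrightarrow> vnorm X (vscale X c x) = \<bar>c\<bar> * vnorm X x"
    and complete: "Metric_space.mcomplete (vcarrier X) (vdist X)"

definition unit_ball :: "'x normed_structure \<Rightarrow> 'x set" where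
  "unit_ball X = {x \<in> vcarrier X. vnorm X x \<le> 1}"

(* T is only relevant on the carrier; its values elsewhere are arbitrary. *)
definition operator_on :: "'x normed_structure \<Rightarrow> ('x \<Rightarrow> 'e::real_normed_vector) \<Rightarrow> bool" where
  "operator_on X T \<longleftrightarrow>
     (\<forall>x \<in> vcarrier X. \<forall>y \<in> vcarrier X. T (vadd X x y) = T x + T y) \<and>
     (\<forall>c. \<forall>x \<in> vcarrier X. T (vscale X c x) = c *\<^sub>R T x) \<and>
     (\<exists>K. \<forall>x \<in> vcarrier X. norm (T x) \<le> K * vnorm X x)"

definition strong_order_bounded :: "'x normed_structure \<Rightarrow> ('x \<Rightarrow> 'e::banach_lattice) \<Rightarrow> bool" where
  "strong_order_bounded X T \<longleftrightarrow> order_bounded (T ` unit_ball X)"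

definition L_weakly_compact_operator ::
    "'x normed_structure \<Rightarrow> ('x \<Rightarrow> 'e::banach_lattice) \<Rightarrow> bool" where
  "L_weakly_compact_operator X T \<longleftrightarrow> L_weakly_compact (T ` unit_ball X)"

definition ell1 :: "(nat \<Rightarrow> real) normed_structure" where
  "ell1 = \<lparr> vcarrier = {f. summable (\<lambda>n. \<bar>f n\<bar>)},
            vzero = (\<lambda>n. 0),
            vadd = (\<lambda>f g n. f n + g n),
            vscale = (\<lambda>c f n. c * f n),
            vnorm = (\<lambda>f. \<Sum>n. \<bar>f n\<bar>) \<rparr>"

(* Every type of class banach is a Banach space in the sense above, with the usual operators. *)
definition type_space :: "'x::real_normed_vector normed_structure" where
  "type_space = \<lparr> vcarrier = UNIV, vzero = 0, vadd = (+), vscale = scaleR, vnorm = norm \<rparr>"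

lemma banach_space_on_type_space: "banach_space_on (type_space :: 'x::banach normed_structure)"
proof -
  have d: "vdist type_space = (dist :: 'x \<Rightarrow> 'x \<Rightarrow> real)"
    by (auto simp: fun_eq_iff vdist_def type_space_def dist_norm)
  have "Metric_space.mcomplete (UNIV :: 'x set) dist"
    by (simp add: complete_UNIV)
  with d show ?thesis
    by unfold_locales
      (auto simp: type_space_def algebra_simps norm_triangle_ineq intro: exI[of _ "- _"])
qed

lemma operator_on_type_space: "operator_on type_space T \<longleftrightarrow> bounded_linear T"
  by (auto simp: operator_on_def type_space_def bounded_linear_def bounded_linear_axioms_def
      linear_iff mult.commute)

end

(* Under an order continuous norm, the partial sums s n of a disjoint sequence in [0, u] increase
   and stay below u.  The differences of the upper bounds of s and the values of s decrease to 0,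
   so s is Cauchy and the sequence is null; hence order bounded sets are L-weakly compact.

   Conversely, a disjoint sequence v in [0, u] defines the operator f \<mapsto> \<Sum>n. f n v n on ell1, which
   is strong order bounded, so (3) makes v null.  If any k + 1 members of a sequence in [0, u] have
   infimum 0, then the sequence is null by induction on k.  It follows that positive terms with order
   bounded partial sums are null, because (w n - u / N)^+ overlaps at most N times.  A set
   decreasing to 0 is therefore norm Cauchy, and its limit is its infimum 0. *)

theory Submission imports Defs begin

section \<open>Elementary facts on Banach lattices\<close>

lemma norm_mono_nonneg:
  fixes x y :: "'e::banach_lattice"
  assumes "0 \<le> x" "x \<le> y"
  shows "norm x \<le> norm y"
  using assms by (intro norm_le_if_abs_le) auto

text \<open>Dividing by \<open>n\<close> bounds the positive part of \<open>l\<close> by that of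
  \<open>w\<close> over \<open>n\<close>. Monotonicity of the norm then makes it vanish.\<close>

lemma archimedean_nonpos:
  fixes l w :: "'e::banach_lattice"
  assumes "\<And>n::nat. real n *\<^sub>R l \<le> w"
  shows "l \<le> 0"
proof -
  have "norm (pprt l) \<le> norm (pprt w) / real (Suc n)" for n
  proof -
    have "l \<le> (1 / real (Suc n)) *\<^sub>R w"
      using scaleR_left_mono[OF assms[of "Suc n"], of "1 / real (Suc n)"] by simp
    also have "\<dots> \<le> (1 / real (Suc n)) *\<^sub>R pprt w"
      by (intro scaleR_left_mono) (simp_all add: pprt_def)
    finally have "pprt l \<le> (1 / real (Suc n)) *\<^sub>R pprt w"
      unfolding pprt_def[of l] by (intro sup_least) (simp_all add: scaleR_nonneg_nonneg)
    then have "norm (pprt l) \<le> norm ((1 / real (Suc n)) *\<^sub>R pprt w)"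
      by (intro norm_mono_nonneg) simp_all
    then show ?thesis by simp
  qed
  moreover have "(\<lambda>n. norm (pprt w) / real (Suc n)) \<longlonglongrightarrow> 0"
    by (rule LIMSEQ_Suc[OF lim_const_over_n])
  ultimately have "norm (pprt l) \<le> 0"
    by (intro LIMSEQ_le_const) auto
  then show ?thesis
    by (simp add: le_zero_iff_zero_pprt)
qed

text \<open>The positive cone is norm closed: x - b \<le> x - f n \<le> |f n - x|, so the positive
  part of \<open>x - b\<close> is dominated in norm by a null sequence.\<close>

lemma tendsto_upperbound_banach_lattice:
  fixes f :: "nat \<Rightarrow> 'e::banach_lattice"
  assumes lim: "f \<longlonglongrightarrow> x" and le: "\<And>n. f n \<le> b"
  shows "x \<le> b"
proof -
  have "norm (pprt (x - b)) \<le> norm (f n - x)" for n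
  proof -
    have "x - b \<le> \<bar>f n - x\<bar>"
      using order_trans[OF diff_left_mono[OF le[of n], of x]] abs_ge_minus_self[of "f n - x"]
      by simp
    then have "pprt (x - b) \<le> \<bar>f n - x\<bar>"
      by (simp add: pprt_def)
    then show ?thesis
      by (intro norm_le_if_abs_le) simp
  qed
  moreover have "(\<lambda>n. norm (f n - x)) \<longlonglongrightarrow> 0"
    using lim LIM_zero tendsto_norm_zero by blast
  ultimately have "norm (pprt (x - b)) \<le> 0"
    by (intro LIMSEQ_le_const) auto
  then show ?thesis
    by (simp add: le_zero_iff_zero_pprt [symmetric])
qed

text \<open>The nontrivial half of the identity (a \<sqinter> b)^+ = a^+ \<sqinter> b^+, proved
  through the negative part.\<close>

lemma le_pprt_inf:
  fixes a b z :: "'e::lattice_ab_group_add"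
  assumes "z \<le> pprt a" "z \<le> pprt b"
  shows "z \<le> pprt (inf a b)"
proof -
  define t where "t = pprt (inf a b)"
  have t: "inf a b \<le> t" "0 \<le> t"
    by (simp_all add: t_def pprt_def)
  \<comment> \<open>The negative part c^+ - c is antitone in \<open>c\<close>. Applied to
    \<open>a\<close> and \<open>b\<close>, this puts \<open>z - t + inf a b\<close> below both,
    hence below their infimum.\<close>
  have *: "pprt c \<le> t + (c - inf a b)" if "inf a b \<le> c" for c
    unfolding pprt_def
  proof (rule sup_least)
    show "c \<le> t + (c - inf a b)"
      using add_right_mono[OF t(1), of "c - inf a b"]
      by (simp only: add_diff_eq add_diff_cancel_left')
    show "0 \<le> t + (c - inf a b)"
      using t(2) that by (intro add_nonneg_nonneg) (simp_all only: diff_ge_0_iff_ge that)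
  qed
  have "z - t + inf a b \<le> c" if "inf a b \<le> c" "z \<le> pprt c" for c
    using order_trans[OF that(2) *[OF that(1)]]
    by (simp only: diff_add_eq diff_le_eq add_diff_eq le_diff_eq add.commute)
  then have "z - t + inf a b \<le> a" "z - t + inf a b \<le> b"
    using assms by simp_all
  then have "z - t + inf a b \<le> inf a b"
    by simp
  then show ?thesis
    using add_le_cancel_right[of "z - t" "inf a b" 0] by (simp only: t_def add_0 diff_le_0_iff_le)
qed

text \<open>Iterates \<open>le_pprt_inf\<close>. The induction builds \<open>q\<close> as the
  infimum of the finite family.\<close>

lemma le_pprt_lower_bound:
  fixes f :: "'i \<Rightarrow> 'e::lattice_ab_group_add"
  assumes "finite I" "I \<noteq> {}" "\<And>i. i \<in> I \<Longrightarrow> z \<le> pprt (f i)"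
  shows "\<exists>q. (\<forall>i\<in>I. q \<le> f i) \<and> z \<le> pprt q"
  using assms
proof (induction rule: finite_ne_induct)
  case (singleton i)
  then show ?case by auto
next
  case (insert i I)
  then obtain q where "\<forall>j\<in>I. q \<le> f j" "z \<le> pprt q"
    by auto
  then have "(\<forall>j\<in>insert i I. inf (f i) q \<le> f j) \<and> z \<le> pprt (inf (f i) q)"
    using insert.prems by (auto intro: le_pprt_inf le_infI2)
  then show ?case by blast
qed

text \<open>With z = y \<sqinter> (a + b), the difference \<open>z - inf y a\<close> is the supremum
  of \<open>z - y\<close> and \<open>z - a\<close>. The first is at most 0, the second is below both
  \<open>y\<close> and \<open>b\<close>.\<close>

lemma inf_add_le:
  fixes a b y :: "'e::lattice_ab_group_add"
  assumes "0 \<le> a" "0 \<le> b" "0 \<le> y"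
  shows "inf y (a + b) \<le> inf y a + inf y b"
proof -
  define z where "z = inf y (a + b)"
  have z: "z \<le> y" "z \<le> a + b"
    by (simp_all add: z_def)
  have "z - inf y a = sup (z - y) (z - a)"
    by (simp add: diff_inf_eq_sup add_sup_distrib_left)
  moreover have "z - y \<le> inf y b"
    using z assms by (auto intro: order_trans[of _ 0])
  moreover have "z - a \<le> inf y b"
    using z assms by (auto simp: algebra_simps add_increasing intro: order_trans)
  ultimately have "z - inf y a \<le> inf y b"
    by simp
  then show ?thesis
    by (simp only: z_def diff_le_eq add.commute)
qed

lemma norm_inf_sum_le:
  fixes p :: "'i \<Rightarrow> 'e::banach_lattice"
  assumes "finite I" "\<And>i. i \<in> I \<Longrightarrow> 0 \<le> p i" "0 \<le> y"
  shows "norm (inf y (sum p I)) \<le> (\<Sum>i\<in>I. norm (inf y (p i)))"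
  using assms
proof (induction rule: finite_induct)
  case empty
  then show ?case by (simp add: inf_absorb2)
next
  case (insert i I)
  have nn: "0 \<le> p i" "0 \<le> sum p I"
    using insert.prems by (auto intro: sum_nonneg)
  have "norm (inf y (p i + sum p I)) \<le> norm (inf y (p i) + inf y (sum p I))"
    using nn insert.prems by (intro norm_mono_nonneg inf_add_le) auto
  also have "\<dots> \<le> norm (inf y (p i)) + norm (inf y (sum p I))"
    by (rule norm_triangle_ineq)
  also have "\<dots> \<le> norm (inf y (p i)) + (\<Sum>i\<in>I. norm (inf y (p i)))"
    using insert by auto
  finally show ?case
    using insert.hyps by simp
qed

text \<open>The two differences are \<open>x\<close> and \<open>- C x\<close> for x = a - u/C. A
  common lower bound \<open>q\<close> satisfies C q \<le> C x \<le> - q, so it is not positive: the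
  parts where a > u/C and a < u/C are disjoint.\<close>

lemma disjoint_pprt:
  fixes a u z :: "'e::banach_lattice"
  assumes C: "C > 0" and z: "z \<le> pprt (a - (1 / C) *\<^sub>R u)" "z \<le> pprt (u - C *\<^sub>R a)"
  shows "z \<le> 0"
proof -
  define q where "q = inf (a - (1 / C) *\<^sub>R u) (u - C *\<^sub>R a)"
  have "C *\<^sub>R q \<le> C *\<^sub>R (a - (1 / C) *\<^sub>R u)"
    using C by (intro scaleR_left_mono) (simp_all add: q_def)
  also have "\<dots> = - (u - C *\<^sub>R a)"
    using C by (simp add: scaleR_diff_right)
  also have "\<dots> \<le> - q"
    by (simp add: q_def)
  finally have "(C + 1) *\<^sub>R q \<le> 0"
    by (simp add: scaleR_add_left algebra_simps le_eq_neg)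
  then have "q \<le> 0"
    using C by (simp add: scaleR_le_0_iff)
  moreover have "z \<le> pprt q"
    unfolding q_def by (intro le_pprt_inf z)
  ultimately show ?thesis
    by simp
qed

section \<open>Order bounded disjoint sequences under an order continuous norm\<close>

text \<open>The sum of two disjoint positive elements is their supremum, so adding a term does not
  leave the bound \<open>u\<close>. Disjointness of the partial sum from all later terms is carried
  along to make this available at the next step.\<close>

lemma sum_disjoint_le:
  fixes x :: "nat \<Rightarrow> 'e::banach_lattice"
  assumes x: "\<And>n. 0 \<le> x n" "\<And>n. x n \<le> u"
    and disj: "disjoint_sequence x"
  shows "sum x {..<n} \<le> u \<and> (\<forall>m\<ge>n. inf (x m) (sum x {..<n}) = 0)"
proof (induction n)
  case 0
  have "0 \<le> u"
    using x order_trans by blast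
  then show ?case
    using x by (simp add: inf_absorb2)
next
  case (Suc n)
  define s where "s = sum x {..<n}"
  have s: "0 \<le> s" "s \<le> u" "\<And>m. m \<ge> n \<Longrightarrow> inf (x m) s = 0"
    using Suc x by (auto simp: s_def intro: sum_nonneg)
  have eq: "sum x {..<Suc n} = s + x n"
    by (simp add: s_def)
  have "x n + s = sup (x n) s"
    using s(3)[of n] add_eq_inf_sup[of "x n" s] by simp
  then have "s + x n \<le> u"
    using s x by (simp add: add.commute)
  moreover have "inf (x m) (s + x n) = 0" if "m \<ge> Suc n" for m
  proof (rule antisym)
    have "inf (x m) (s + x n) \<le> inf (x m) s + inf (x m) (x n)"
      using s x by (intro inf_add_le) auto
    moreover have "inf (x m) (x n) = 0"
      using disj that x unfolding disjoint_sequence_def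
      by (metis Suc_n_not_le_n abs_of_nonneg)
    ultimately show "inf (x m) (s + x n) \<le> 0"
      using s(3)[of m] that by simp
    show "0 \<le> inf (x m) (s + x n)"
      using s x by simp
  qed
  ultimately show ?case
    unfolding eq by blast
qed

section \<open>Order continuity of the norm without filters\<close>

lemma eventually_tails_iff:
  assumes "decreases_to_zero D"
  shows "eventually P (INF d\<in>D. principal {x \<in> D. x \<le> d})
    \<longleftrightarrow> (\<exists>d\<in>D. \<forall>x\<in>D. x \<le> d \<longrightarrow> P x)"
proof -
  have "eventually P (INF d\<in>D. principal {x \<in> D. x \<le> d})
    \<longleftrightarrow> (\<exists>d\<in>D. eventually P (principal {x \<in> D. x \<le> d}))"
  proof (rule eventually_INF_base)
    show "D \<noteq> {}"
      using assms by (simp add: decreases_to_zero_def)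
    fix a b assume "a \<in> D" "b \<in> D"
    then obtain z where "z \<in> D" "z \<le> a" "z \<le> b"
      using assms unfolding decreases_to_zero_def by blast
    then show "\<exists>z\<in>D. principal {x \<in> D. x \<le> z}
        \<le> inf (principal {x \<in> D. x \<le> a}) (principal {x \<in> D. x \<le> b})"
      by (intro bexI[of _ z]) (auto intro: order_trans)
  qed
  then show ?thesis
    by (auto simp: eventually_principal)
qed

text \<open>The norm is monotone on the positive cone, so a single member of small norm makes its
  whole tail small.\<close>

lemma tendsto_tails_iff:
  assumes "decreases_to_zero (D :: 'e::banach_lattice set)"
  shows "(norm \<longlongrightarrow> 0) (INF d\<in>D. principal {x \<in> D. x \<le> d}) \<longleftrightarrow> (\<forall>\<epsilon>>0. \<exists>d\<in>D. norm d < \<epsilon>)"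
proof
  assume lim: "(norm \<longlongrightarrow> 0) (INF d\<in>D. principal {x \<in> D. x \<le> d})"
  show "\<forall>\<epsilon>>0. \<exists>d\<in>D. norm d < \<epsilon>"
  proof (intro allI impI)
    fix \<epsilon> :: real assume "\<epsilon> > 0"
    then have "eventually (\<lambda>x. dist (norm x) 0 < \<epsilon>) (INF d\<in>D. principal {x \<in> D. x \<le> d})"
      using lim by (simp only: tendsto_iff)
    then show "\<exists>d\<in>D. norm d < \<epsilon>"
      unfolding eventually_tails_iff[OF assms] by auto
  qed
next
  assume small: "\<forall>\<epsilon>>0. \<exists>d\<in>D. norm d < \<epsilon>"
  show "(norm \<longlongrightarrow> 0) (INF d\<in>D. principal {x \<in> D. x \<le> d})"
    unfolding tendsto_iff eventually_tails_iff[OF assms]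
  proof (intro allI impI)
    fix \<epsilon> :: real assume "\<epsilon> > 0"
    then obtain d where d: "d \<in> D" "norm d < \<epsilon>"
      using small by blast
    have "norm x < \<epsilon>" if "x \<in> D" "x \<le> d" for x
    proof -
      have "0 \<le> x"
        using assms that by (simp add: decreases_to_zero_def)
      then show ?thesis
        using norm_mono_nonneg[of x d] that d by simp
    qed
    with d show "\<exists>d\<in>D. \<forall>x\<in>D. x \<le> d \<longrightarrow> dist (norm x) 0 < \<epsilon>"
      by auto
  qed
qed

lemma order_continuous_norm_iff:
  "order_continuous_norm TYPE('e::banach_lattice) \<longleftrightarrow>
    (\<forall>D :: 'e set. decreases_to_zero D \<longrightarrow> (\<forall>\<epsilon>>0. \<exists>d\<in>D. norm d < \<epsilon>))"
proof
  assume oc: "order_continuous_norm TYPE('e)"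
  show "\<forall>D :: 'e set. decreases_to_zero D \<longrightarrow> (\<forall>\<epsilon>>0. \<exists>d\<in>D. norm d < \<epsilon>)"
  proof (rule allI, rule impI)
    fix D :: "'e set" assume D: "decreases_to_zero D"
    have "(norm \<longlongrightarrow> 0) (INF d\<in>D. principal {x \<in> D. x \<le> d})"
      by (rule oc[unfolded order_continuous_norm_def, rule_format, OF D])
    then show "\<forall>\<epsilon>>0. \<exists>d\<in>D. norm d < \<epsilon>"
      by (rule iffD1[OF tendsto_tails_iff[OF D]])
  qed
next
  assume small: "\<forall>D :: 'e set. decreases_to_zero D \<longrightarrow> (\<forall>\<epsilon>>0. \<exists>d\<in>D. norm d < \<epsilon>)"
  show "order_continuous_norm TYPE('e)"
    unfolding order_continuous_norm_def
  proof (rule allI, rule impI)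
    fix D :: "'e set" assume D: "decreases_to_zero D"
    show "(norm \<longlongrightarrow> 0) (INF d\<in>D. principal {x \<in> D. x \<le> d})"
      by (rule iffD2[OF tendsto_tails_iff[OF D] small[THEN spec, THEN mp, OF D]])
  qed
qed

text \<open>An increasing bounded sequence may have no supremum in \<open>'e\<close>, so all its
  upper bounds together take that role. A lower bound \<open>l\<close> of the differences can be
  subtracted from \<open>u\<close> any number of times, and the Archimedean property gives l \<le>
  0.\<close>

lemma decreases_to_zero_upper_bounds_diff:
  fixes s :: "nat \<Rightarrow> 'e::banach_lattice"
  assumes "incseq s" "\<And>n. s n \<le> u"
  shows "decreases_to_zero {z - s n |z n. \<forall>m. s m \<le> z}" (is "decreases_to_zero ?D")
  unfolding decreases_to_zero_def
proof (intro conjI ballI allI impI)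
  show "?D \<noteq> {}"
    using assms by blast
next
  fix x y assume "x \<in> ?D" "y \<in> ?D"
  then obtain z n z' n' where *: "\<forall>m. s m \<le> z" "x = z - s n" "\<forall>m. s m \<le> z'" "y = z' - s n'"
    by blast
  show "\<exists>w\<in>?D. w \<le> x \<and> w \<le> y"
  proof (rule bexI[of _ "inf z z' - s (max n n')"])
    show "inf z z' - s (max n n') \<le> x \<and> inf z z' - s (max n n') \<le> y"
      unfolding * using incseqD[OF assms(1)] by (intro conjI diff_mono) auto
    have "\<forall>m. s m \<le> inf z z'"
      using * by simp
    then show "inf z z' - s (max n n') \<in> ?D"
      by blast
  qed
next
  fix x assume "x \<in> ?D"
  then show "0 \<le> x" by auto
next
  fix l assume l: "\<forall>x\<in>?D. l \<le> x"
  (* If z is an upper bound of s, then so is z - l. *)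
  have "\<forall>m. s m \<le> u - real k *\<^sub>R l" for k
  proof (induction k)
    case 0
    then show ?case using assms by simp
  next
    case (Suc k)
    have "l \<le> u - real k *\<^sub>R l - s m" for m
      using Suc l by blast
    then show ?case
      by (simp add: algebra_simps)
  qed
  then have "s 0 \<le> u - real k *\<^sub>R l" for k
    by blast
  then show "l \<le> 0"
    by (intro archimedean_nonpos[of _ "u - s 0"]) (simp add: algebra_simps)
qed

lemma order_continuous_norm_disjoint_tendsto_0:
  fixes x :: "nat \<Rightarrow> 'e::banach_lattice"
  assumes oc: "order_continuous_norm TYPE('e)"
    and disj: "disjoint_sequence x" and x: "\<And>n. 0 \<le> x n" "\<And>n. x n \<le> u"
  shows "(\<lambda>n. norm (x n)) \<longlonglongrightarrow> 0"
proof (rule LIMSEQ_I)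
  fix \<epsilon> :: real assume "\<epsilon> > 0"
  define s where "s n = sum x {..<n}" for n
  have "incseq s"
    using x by (simp add: incseq_SucI s_def)
  moreover have "s n \<le> u" for n
    using sum_disjoint_le[OF x disj] by (simp add: s_def)
  ultimately have "\<exists>d\<in>{z - s n |z n. \<forall>m. s m \<le> z}. norm d < \<epsilon>"
    using oc \<open>\<epsilon> > 0\<close> decreases_to_zero_upper_bounds_diff
    unfolding order_continuous_norm_iff by blast
  then obtain z n where z: "\<forall>m. s m \<le> z" "norm (z - s n) < \<epsilon>"
    by auto
  \<comment> \<open>Each later term is an increment of \<open>s\<close> after index
    \<open>n\<close>, and all of these fit between \<open>s n\<close> and \<open>z\<close>.\<close>
  have "norm (x m) < \<epsilon>" if "m \<ge> n" for m
  proof -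
    have "s n + x m \<le> s m + x m"
      using incseqD[OF \<open>incseq s\<close> that] by simp
    also have "s m + x m = s (Suc m)"
      by (simp add: s_def)
    also have "\<dots> \<le> z"
      using z by blast
    finally have "x m \<le> z - s n"
      by (simp add: algebra_simps)
    then have "norm (x m) \<le> norm (z - s n)"
      using x by (intro norm_mono_nonneg)
    then show ?thesis
      using z by simp
  qed
  then show "\<exists>n. \<forall>m\<ge>n. norm (norm (x m) - 0) < \<epsilon>"
    by auto
qed

section \<open>Order bounded sets are L-weakly compact\<close>

lemma order_bounded_abs_le:
  assumes "order_bounded (A :: 'e::banach_lattice set)"
  obtains u where "\<And>x. x \<in> A \<Longrightarrow> \<bar>x\<bar> \<le> u"
proof -
  obtain a b where "A \<subseteq> {a..b}"
    using assms unfolding order_bounded_def by blast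
  then have "\<bar>x\<bar> \<le> sup \<bar>a\<bar> \<bar>b\<bar>" if "x \<in> A" for x
  proof (intro abs_leI)
    have "a \<le> x" "x \<le> b"
      using that \<open>A \<subseteq> {a..b}\<close> by auto
    then show "x \<le> sup \<bar>a\<bar> \<bar>b\<bar>" "- x \<le> sup \<bar>a\<bar> \<bar>b\<bar>"
      using abs_ge_self[of b] abs_ge_minus_self[of a]
      by (meson le_supI1 le_supI2 order_trans neg_le_iff_le)+
  qed
  then show ?thesis
    using that by blast
qed

text \<open>The elements with absolute value below \<open>u\<close> form a solid set, which
  therefore contains the hull.\<close>

lemma solid_hull_abs_le:
  assumes "\<And>x. x \<in> A \<Longrightarrow> \<bar>x\<bar> \<le> u" "y \<in> solid hull A"
  shows "\<bar>y\<bar> \<le> (u :: 'e::banach_lattice)"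
proof -
  have "solid hull A \<subseteq> {x. \<bar>x\<bar> \<le> u}"
    using assms(1) by (intro hull_minimal) (auto simp: solid_def intro: order_trans)
  then show ?thesis
    using assms(2) by blast
qed

lemma order_continuous_norm_imp_L_weakly_compact:
  fixes A :: "'e::banach_lattice set"
  assumes oc: "order_continuous_norm TYPE('e)" and A: "order_bounded A" "A \<noteq> {}"
  shows "L_weakly_compact A"
proof -
  obtain u where u: "\<And>x. x \<in> A \<Longrightarrow> \<bar>x\<bar> \<le> u"
    using order_bounded_abs_le[OF A(1)] by blast
  have "bounded A"
    unfolding bounded_iff
  proof (intro exI ballI)
    fix x assume "x \<in> A"
    then show "norm x \<le> norm u"
      using u by (intro norm_le_if_abs_le order_trans[OF u abs_ge_self])
  qed
  moreover have "(\<lambda>n. norm (x n)) \<longlonglongrightarrow> 0"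
    if x: "disjoint_sequence x" "range x \<subseteq> solid hull A" for x
  proof -
    have norm_abs: "norm \<bar>y\<bar> = norm y" for y :: 'e
      by (intro antisym norm_le_if_abs_le) simp_all
    \<comment> \<open>Disjointness and norm depend only on absolute values, so the sequence may be
      replaced by a positive one in [0, u].\<close>
    have "disjoint_sequence (\<lambda>n. \<bar>x n\<bar>)"
      using x(1) by (simp add: disjoint_sequence_def)
    moreover have "\<bar>x n\<bar> \<le> u" for n
      using x(2) by (intro solid_hull_abs_le[OF u]) auto
    ultimately have "(\<lambda>n. norm \<bar>x n\<bar>) \<longlonglongrightarrow> 0"
      by (intro order_continuous_norm_disjoint_tendsto_0[OF oc]) auto
    then show ?thesis
      by (simp add: norm_abs)
  qed
  ultimately show ?thesis
    using A(2) by (auto simp: L_weakly_compact_def)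
qed

section \<open>Order continuity from order bounded disjoint sequences\<close>

text \<open>If the sequence were not null, it would have a subsequence of large terms that nearly
  avoid multiples of their predecessors. Cutting off the remaining overlap makes the terms exactly
  disjoint and hence null by \<open>disjoint_null\<close>, although too little norm was removed for
  that.\<close>

lemma finite_overlap_tendsto_0:
  fixes y :: "nat \<Rightarrow> 'e::banach_lattice"
  assumes disjoint_null: "\<And>v :: nat \<Rightarrow> 'e. disjoint_sequence v \<Longrightarrow> (\<And>n. 0 \<le> v n)
      \<Longrightarrow> (\<And>n. v n \<le> u) \<Longrightarrow> (\<lambda>n. norm (v n)) \<longlonglongrightarrow> 0"
    and "\<And>n. 0 \<le> y n" "\<And>n. y n \<le> u"
    and "\<And>I z. finite I \<Longrightarrow> card I = Suc k \<Longrightarrow> 0 \<le> z \<Longrightarrow> (\<And>i. i \<in> I \<Longrightarrow> z \<le> y i) \<Longrightarrow> z = 0"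
  shows "(\<lambda>n. norm (y n)) \<longlonglongrightarrow> 0"
  using assms(2-)
proof (induction k arbitrary: y)
  case 0
  have "y n = 0" for n
    by (rule "0.prems"(3)[of "{n}"]) (simp_all add: "0.prems"(1))
  then show ?case by simp
next
  case (Suc k)
  note y = Suc.prems(1,2) and overlap = Suc.prems(3)
  have u: "0 \<le> u"
    using y[of 0] by (rule order_trans)
  show ?case
  proof (rule ccontr)
    assume "\<not> (\<lambda>n. norm (y n)) \<longlonglongrightarrow> 0"
    then obtain \<epsilon> where \<epsilon>: "\<epsilon> > 0" and large: "\<And>N. \<exists>n\<ge>N. \<epsilon> \<le> norm (y n)"
      unfolding LIMSEQ_def by (auto simp: not_less)
    \<comment> \<open>The bound \<open>C \<ge> 1\<close> lets \<open>w / C\<close> stay below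
      whatever dominates a positive \<open>w\<close>. The other bound makes the later cut
      \<open>e = u / C\<close> cost at most a quarter of \<epsilon>.\<close>
    define C where "C = max 1 (4 * norm u / \<epsilon>)"
    have C: "C \<ge> 1" "norm u / C \<le> \<epsilon> / 4"
      using \<epsilon> by (auto simp: C_def field_simps max_def)
    have Cy: "0 \<le> C *\<^sub>R y i" for i
      using C y by (simp add: scaleR_nonneg_nonneg)
    (* If k + 1 of the sequence y n \<sqinter> C y i lie above w, then k + 2 of y lie above w / C. *)
    have null: "(\<lambda>n. norm (inf (y n) (C *\<^sub>R y i))) \<longlonglongrightarrow> 0" for i
    proof -
      \<comment> \<open>At index \<open>i\<close> itself the infimum would be \<open>y i\<close> and
        gain no new index. The value 0 settles every \<open>I\<close> containing \<open>i\<close>;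
        any other \<open>I\<close> grows to k + 2 indices when \<open>i\<close> is inserted.\<close>
      define z where "z n = (if n = i then 0 else inf (y n) (C *\<^sub>R y i))" for n
      have "(\<lambda>n. norm (z n)) \<longlonglongrightarrow> 0"
      proof (rule Suc.IH)
        show "0 \<le> z n" "z n \<le> u" for n
          using y u Cy by (auto simp: z_def intro: le_infI1)
        fix I w
        assume I: "finite I" "card I = Suc k" and w: "0 \<le> w" "\<And>j. j \<in> I \<Longrightarrow> w \<le> z j"
        show "w = 0"
        proof (cases "i \<in> I")
          case True
          then show ?thesis
            using w(1) w(2)[of i] by (simp add: z_def)
        next
          case False
          have w': "w \<le> y j" "w \<le> C *\<^sub>R y i" if "j \<in> I" for j
            using w(2)[OF that] that False by (auto simp: z_def split: if_splits)
          obtain j where "j \<in> I"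
            using I by fastforce
          have "(1 / C) *\<^sub>R w \<le> (1 / C) *\<^sub>R (C *\<^sub>R y i)"
            using w'(2)[OF \<open>j \<in> I\<close>] C by (intro scaleR_left_mono) auto
          then have yi: "(1 / C) *\<^sub>R w \<le> y i"
            using C by simp
          have "(1 / C) *\<^sub>R w \<le> 1 *\<^sub>R w"
            using C w by (intro scaleR_right_mono) auto
          then have yj: "(1 / C) *\<^sub>R w \<le> y j" if "j \<in> I" for j
            using w'(1)[OF that] by simp
          have "(1 / C) *\<^sub>R w = 0"
          proof (rule overlap)
            show "finite (insert i I)" "card (insert i I) = Suc (Suc k)"
              using I False by auto
            show "0 \<le> (1 / C) *\<^sub>R w"
              using w C by (simp add: scaleR_nonneg_nonneg)
            show "(1 / C) *\<^sub>R w \<le> y l" if "l \<in> insert i I" for l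
              using yi yj that by blast
          qed
          then show ?thesis
            using C by simp
        qed
      qed
      moreover have "eventually (\<lambda>n. norm (z n) = norm (inf (y n) (C *\<^sub>R y i))) sequentially"
        using eventually_gt_at_top[of i] by eventually_elim (simp add: z_def)
      ultimately show ?thesis
        by (rule Lim_transform_eventually)
    qed
    \<comment> \<open>For fixed \<open>N\<close> the overlaps with the finitely many
      \<open>C y i\<close> are null, and together they dominate the overlap with \<open>C\<close>
      times the sum.\<close>
    have "\<exists>n>N. \<epsilon> \<le> norm (y n) \<and> norm (inf (y n) (C *\<^sub>R (\<Sum>i\<le>N. y i))) < \<epsilon> / 4" for N
    proof -
      have "(\<lambda>n. \<Sum>i\<le>N. norm (inf (y n) (C *\<^sub>R y i))) \<longlonglongrightarrow> 0"
        by (intro tendsto_null_sum null)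
      then have "eventually (\<lambda>n. (\<Sum>i\<le>N. norm (inf (y n) (C *\<^sub>R y i))) < \<epsilon> / 4) sequentially"
        using \<epsilon> by (intro order_tendstoD(2)) auto
      then obtain M where M: "\<And>n. n \<ge> M \<Longrightarrow> (\<Sum>i\<le>N. norm (inf (y n) (C *\<^sub>R y i))) < \<epsilon> / 4"
        unfolding eventually_sequentially by blast
      obtain n where n: "n \<ge> max M (Suc N)" "\<epsilon> \<le> norm (y n)"
        using large by blast
      have "norm (inf (y n) (\<Sum>i\<le>N. C *\<^sub>R y i)) \<le> (\<Sum>i\<le>N. norm (inf (y n) (C *\<^sub>R y i)))"
        using Cy y by (intro norm_inf_sum_le) auto
      also have "\<dots> < \<epsilon> / 4"
        using M n by simp
      finally show ?thesis
        using n by (intro exI[of _ n]) (simp add: scaleR_sum_right)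
    qed
    then obtain g where g: "\<And>N. g N > N" "\<And>N. \<epsilon> \<le> norm (y (g N))"
        "\<And>N. norm (inf (y (g N)) (C *\<^sub>R (\<Sum>i\<le>N. y i))) < \<epsilon> / 4"
      by metis
    define r where "r j = (g ^^ j) 0" for j
    have r_Suc: "r (Suc j) = g (r j)" for j
      by (simp add: r_def)
    have "strict_mono r"
      using g(1) by (intro strict_monoI_Suc) (simp add: r_Suc)
    then have r_mono: "r i \<le> r j" if "i \<le> j" for i j
      using that by (simp add: strict_mono_less_eq)
    \<comment> \<open>For i < j this sum contains \<open>y (r (Suc i))\<close>, so subtracting
      \<open>p j\<close> removes \<open>C\<close> times every term selected earlier.\<close>
    define p where "p j = C *\<^sub>R (\<Sum>i\<le>r j. y i)" for j
    have p: "0 \<le> p j" for j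
      using C y by (simp add: p_def scaleR_nonneg_nonneg sum_nonneg)
    define e where "e = (1 / C) *\<^sub>R u"
    have e: "0 \<le> e"
      using C u by (simp add: e_def scaleR_nonneg_nonneg)
    define v where "v j = pprt (y (r (Suc j)) - p j - e)" for j
    (* v i and v j live on the disjoint parts y (r (i + 1)) > u / C and y (r (i + 1)) < u / C. *)
    have v_le: "v j \<le> pprt (y (r (Suc j)) - e)" for j
      unfolding v_def by (intro pprt_mono diff_right_mono) (use p[of j] in simp)
    have disj: "inf (v i) (v j) = 0" if "i < j" for i j
    proof (rule antisym)
      have "y (r (Suc i)) \<le> (\<Sum>l\<le>r j. y l)"
        using y r_mono[of "Suc i" j] that sum_mono2[of "{..r j}" "{r (Suc i)}" y] by simp
      then have "C *\<^sub>R y (r (Suc i)) \<le> p j"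
        unfolding p_def using C by (intro scaleR_left_mono) auto
      then have "y (r (Suc j)) - p j - e \<le> u - C *\<^sub>R y (r (Suc i)) - 0"
        using y e by (intro diff_mono) auto
      then have "v j \<le> pprt (u - C *\<^sub>R y (r (Suc i)))"
        unfolding v_def by (intro pprt_mono) simp
      then show "inf (v i) (v j) \<le> 0"
        using C v_le[of i] unfolding e_def
        by (intro disjoint_pprt[of C _ "y (r (Suc i))" u]) (auto intro: le_infI1 le_infI2)
      show "0 \<le> inf (v i) (v j)"
        by (simp add: v_def)
    qed
    have "(\<lambda>j. norm (v j)) \<longlonglongrightarrow> 0"
    proof (rule disjoint_null)
      have "inf (v i) (v j) = 0" if "i \<noteq> j" for i j
        using that disj[of i j] disj[of j i] by (cases "i < j") (auto simp: inf.commute)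
      moreover have "\<bar>v j\<bar> = v j" for j
        by (simp add: v_def)
      ultimately show "disjoint_sequence v"
        by (simp add: disjoint_sequence_def)
      show "0 \<le> v j" for j
        by (simp add: v_def)
      have "pprt (y (r (Suc j)) - e) \<le> u" for j
        using y[of "r (Suc j)"] u e diff_mono[OF y(2)[of "r (Suc j)"] e] unfolding pprt_def
        by (intro sup_least) simp_all
      then show "v j \<le> u" for j
        using v_le order_trans by blast
    qed
    then have "eventually (\<lambda>j. norm (v j) < \<epsilon> / 2) sequentially"
      using \<epsilon> by (intro order_tendstoD(2)) auto
    then obtain j where j: "norm (v j) < \<epsilon> / 2"
      unfolding eventually_sequentially by blast
    define a where "a = y (r (Suc j))"
    \<comment> \<open>The term splits into its overlap with \<open>p j\<close>, of norm below
      \<epsilon>/4, and a rest dominated by \<open>v j + e\<close>, of norm below \<epsilon>/2 +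
      \<epsilon>/4. The total is below \<epsilon>, against the choice of \<open>a\<close>.\<close>
    have "a - inf a (p j) = pprt (a - p j)"
      by (simp add: pprt_def diff_inf_eq_sup add_sup_distrib_left sup.commute)
    then have "norm a = norm (inf a (p j) + pprt (a - p j))"
      by (metis diff_add_cancel add.commute)
    moreover have "pprt (a - p j) \<le> v j + e"
      unfolding pprt_def
    proof (rule sup_least)
      have "a - p j - e \<le> v j"
        unfolding v_def a_def pprt_def by simp
      then show "a - p j \<le> v j + e"
        by (simp only: diff_le_eq)
      show "0 \<le> v j + e"
        using e by (simp add: v_def)
    qed
    then have "norm (pprt (a - p j)) \<le> norm (v j + e)"
      by (intro norm_mono_nonneg) auto
    moreover have "norm (inf a (p j)) < \<epsilon> / 4"
      using g(3)[of "r j"] by (simp add: a_def p_def r_Suc)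
    moreover have "norm e \<le> \<epsilon> / 4"
      using C by (simp add: e_def)
    moreover have "\<epsilon> \<le> norm a"
      using g(2)[of "r j"] by (simp add: a_def r_Suc)
    moreover note norm_triangle_ineq[of "inf a (p j)" "pprt (a - p j)"] norm_triangle_ineq[of "v j" e]
    ultimately show False
      using j by linarith
  qed
qed

text \<open>Each term is cut at the level u/(N+1). The part below the level is small in norm; the
  parts above it satisfy the overlap condition, since N + 1 of them with a common positive piece
  would push a partial sum beyond \<open>u\<close>.\<close>

lemma bounded_sums_tendsto_0:
  fixes w :: "nat \<Rightarrow> 'e::banach_lattice"
  assumes disjoint_null: "\<And>v :: nat \<Rightarrow> 'e. disjoint_sequence v \<Longrightarrow> (\<And>n. 0 \<le> v n)
      \<Longrightarrow> (\<And>n. v n \<le> u) \<Longrightarrow> (\<lambda>n. norm (v n)) \<longlonglongrightarrow> 0"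
    and w: "\<And>n. 0 \<le> w n" and sums: "\<And>n. sum w {..<n} \<le> u"
  shows "(\<lambda>n. norm (w n)) \<longlonglongrightarrow> 0"
proof (rule LIMSEQ_I)
  fix \<epsilon> :: real assume \<epsilon>: "\<epsilon> > 0"
  have u: "0 \<le> u"
    using sums[of 0] by simp
  have w_le: "w n \<le> u" for n
  proof -
    have "w n \<le> sum w {..<Suc n}"
      using sum_mono2[of "{..<Suc n}" "{n}" w] w by simp
    then show ?thesis
      using sums order_trans by blast
  qed
  obtain N where N: "norm u / real (Suc N) < \<epsilon> / 2"
    using order_tendstoD(2)[OF LIMSEQ_Suc[OF lim_const_over_n], of "\<epsilon> / 2" "norm u"] \<epsilon>
    unfolding eventually_sequentially by auto
  define e where "e = (1 / real (Suc N)) *\<^sub>R u"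
  have e: "0 \<le> e"
    using u by (simp add: e_def scaleR_nonneg_nonneg)
  define y where "y n = pprt (w n - e)" for n
  have y: "y n \<le> u" for n
    using u diff_mono[OF w_le[of n] e] unfolding y_def pprt_def by (intro sup_least) simp_all
  have "(\<lambda>n. norm (y n)) \<longlonglongrightarrow> 0"
  proof (rule finite_overlap_tendsto_0[OF disjoint_null])
    show "0 \<le> y n" for n
      by (simp add: y_def)
    fix I z
    assume I: "finite I" "card I = Suc N" and z: "0 \<le> z" "\<And>i. i \<in> I \<Longrightarrow> z \<le> y i"
    have "I \<noteq> {}"
      using I by auto
    \<comment> \<open>A common lower bound of the differences themselves, not of their positive
      parts, can be added up over \<open>I\<close> and compared with \<open>u\<close>.\<close>
    then obtain q where q: "\<forall>i\<in>I. q \<le> w i - e" "z \<le> pprt q"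
      using le_pprt_lower_bound[OF I(1), of z "\<lambda>i. w i - e"] z(2) unfolding y_def by blast
    have "real (Suc N) *\<^sub>R q = (\<Sum>i\<in>I. q)"
      using I by (simp add: sum_constant_scaleR)
    also have "\<dots> \<le> (\<Sum>i\<in>I. w i - e)"
      using q by (intro sum_mono) auto
    \<comment> \<open>The N + 1 copies of \<open>e\<close> add up to exactly
      \<open>u\<close>.\<close>
    also have "\<dots> = sum w I - u"
      using I by (simp add: sum_subtractf sum_constant_scaleR e_def)
    also have "sum w I \<le> sum w {..<Suc (Max I)}"
      using I w by (intro sum_mono2) (auto simp: less_Suc_eq_le)
    also have "\<dots> \<le> u"
      by (rule sums)
    finally have "real (Suc N) *\<^sub>R q \<le> 0"
      by simp
    then have "q \<le> 0"
      by (simp add: scaleR_le_0_iff)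
    then show "z = 0"
      using z q by simp
  qed (use y in auto)
  then have small: "eventually (\<lambda>n. norm (y n) < \<epsilon> / 2) sequentially"
    using \<epsilon> by (intro order_tendstoD(2)) auto
  have norm_w: "norm (w n) \<le> norm (y n) + norm u / real (Suc N)" for n
  proof -
    have "w n - e \<le> y n"
      unfolding y_def pprt_def by simp
    then have "w n \<le> y n + e"
      by (simp only: diff_le_eq)
    then have "norm (w n) \<le> norm (y n + e)"
      using w by (intro norm_mono_nonneg)
    also have "\<dots> \<le> norm (y n) + norm e"
      by (rule norm_triangle_ineq)
    finally show ?thesis
      by (simp add: e_def)
  qed
  have "norm (w n) < \<epsilon>" if "norm (y n) < \<epsilon> / 2" for n
    using norm_w[of n] that N by linarith
  then have "eventually (\<lambda>n. norm (w n) < \<epsilon>) sequentially"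
    by (rule eventually_mono[OF small])
  then show "\<exists>n. \<forall>m\<ge>n. norm (norm (w m) - 0) < \<epsilon>"
    by (simp add: eventually_sequentially)
qed

text \<open>A decreasing sequence in \<open>D\<close> is chosen to run so deep that it is Cauchy and
  its limit lies below all of \<open>D\<close>. As the infimum of \<open>D\<close> is 0, the limit
  is 0.\<close>

lemma decreases_to_zero_small_norm:
  fixes D :: "'e::banach_lattice set"
  assumes disjoint_null: "\<And>(v :: nat \<Rightarrow> 'e) u. disjoint_sequence v \<Longrightarrow> (\<And>n. 0 \<le> v n)
      \<Longrightarrow> (\<And>n. v n \<le> u) \<Longrightarrow> (\<lambda>n. norm (v n)) \<longlonglongrightarrow> 0"
    and D: "decreases_to_zero D" and \<epsilon>: "\<epsilon> > 0"
  shows "\<exists>d\<in>D. norm d < \<epsilon>"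
proof -
  have D_ne: "D \<noteq> {}" and D_nonneg: "\<And>x. x \<in> D \<Longrightarrow> 0 \<le> x"
    and D_directed: "\<And>x y. x \<in> D \<Longrightarrow> y \<in> D \<Longrightarrow> \<exists>z\<in>D. z \<le> x \<and> z \<le> y"
    and D_inf: "\<And>l. (\<And>x. x \<in> D \<Longrightarrow> l \<le> x) \<Longrightarrow> l \<le> 0"
    using D unfolding decreases_to_zero_def by blast+
  \<comment> \<open>Otherwise one could descend in \<open>D\<close> forever by steps of norm at
    least \<delta>. These steps are positive and telescope to at most \<open>s 0\<close>, so they
    would have to be null.\<close>
  have close: "\<exists>d\<in>D. \<forall>d'\<in>D. d' \<le> d \<longrightarrow> norm (d - d') < \<delta>" if \<delta>: "\<delta> > 0" for \<delta>
  proof (rule ccontr)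
    assume "\<not> ?thesis"
    then have "\<forall>d\<in>D. \<exists>d'\<in>D. d' \<le> d \<and> \<delta> \<le> norm (d - d')"
      by (auto simp: not_less)
    then obtain g where g: "\<And>d. d \<in> D \<Longrightarrow> g d \<in> D \<and> g d \<le> d \<and> \<delta> \<le> norm (d - g d)"
      by metis
    obtain d0 where "d0 \<in> D"
      using D_ne by blast
    define s where "s n = (g ^^ n) d0" for n
    have s: "s n \<in> D" for n
      by (induction n) (use g \<open>d0 \<in> D\<close> in \<open>auto simp: s_def\<close>)
    have s_Suc: "s (Suc n) = g (s n)" for n
      by (simp add: s_def)
    have "(\<lambda>n. norm (s n - s (Suc n))) \<longlonglongrightarrow> 0"
    proof (rule bounded_sums_tendsto_0[OF disjoint_null])
      show "0 \<le> s n - s (Suc n)" for n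
        using g[OF s[of n]] by (simp add: s_Suc)
      show "(\<Sum>i<n. s i - s (Suc i)) \<le> s 0" for n
        using D_nonneg[OF s[of n]] by (simp add: sum_lessThan_telescope')
    qed
    then have "eventually (\<lambda>n. norm (s n - s (Suc n)) < \<delta>) sequentially"
      using \<delta> by (rule order_tendstoD(2))
    then obtain n where "norm (s n - g (s n)) < \<delta>"
      unfolding eventually_sequentially s_Suc by blast
    then show False
      using g[OF s[of n]] by simp
  qed
  define P where "P n d \<longleftrightarrow> d \<in> D \<and> (\<forall>d'\<in>D. d' \<le> d \<longrightarrow> norm (d - d') < 1 / real (Suc n))" for n d
  have "\<exists>f. \<forall>n. P n (f n) \<and> f (Suc n) \<le> f n"
  proof (rule dependent_nat_choice)
    show "\<exists>d. P 0 d"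
      using close[of 1] by (auto simp: P_def)
    fix d n assume "P n d"
    obtain c where c: "c \<in> D" "\<And>d'. d' \<in> D \<Longrightarrow> d' \<le> c \<Longrightarrow> norm (c - d') < 1 / real (Suc (Suc n))"
      using close[of "1 / real (Suc (Suc n))"] by auto
    \<comment> \<open>Descending below \<open>c\<close> preserves the estimate: for d' \<le> b, the
      difference \<open>b - d'\<close> is positive and below \<open>c - d'\<close>.\<close>
    obtain b where b: "b \<in> D" "b \<le> d" "b \<le> c"
      using D_directed[of d c] \<open>P n d\<close> c(1) by (auto simp: P_def)
    have "norm (b - d') < 1 / real (Suc (Suc n))" if "d' \<in> D" "d' \<le> b" for d'
    proof -
      have "norm (b - d') \<le> norm (c - d')"
        using that b by (intro norm_mono_nonneg diff_right_mono) auto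
      then show ?thesis
        using c(2)[OF that(1) order_trans[OF that(2) b(3)]] by (rule le_less_trans)
    qed
    then show "\<exists>b. P (Suc n) b \<and> b \<le> d"
      using b by (auto simp: P_def)
  qed
  then obtain f where f: "\<And>n. P n (f n)" "\<And>n. f (Suc n) \<le> f n"
    by blast
  have f_mono: "f m \<le> f n" if "n \<le> m" for m n
    using that f(2) by (rule lift_Suc_antimono_le[rotated])
  have f_close: "norm (f n - d) < 1 / real (Suc n)" if "d \<in> D" "d \<le> f n" for n d
    using f(1)[of n] that by (auto simp: P_def)
  have f_D: "f n \<in> D" for n
    using f(1)[of n] by (simp add: P_def)
  have inverse_null: "(\<lambda>n. 1 / real (Suc n)) \<longlonglongrightarrow> 0"
    by (rule LIMSEQ_Suc[OF lim_const_over_n])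
  have "Cauchy f"
  proof (rule CauchyI')
    fix \<delta> :: real assume "\<delta> > 0"
    then obtain n where n: "1 / real (Suc n) < \<delta> / 2"
      using order_tendstoD(2)[OF inverse_null, of "\<delta> / 2"] unfolding eventually_sequentially by auto
    have "norm (f k - f m) < \<delta>" if "k \<ge> n" "m > k" for k m
    proof -
      have "norm (f n - f m) < 1 / real (Suc n)" "norm (f n - f k) < 1 / real (Suc n)"
        using that by (intro f_close f_D f_mono; simp)+
      then show ?thesis
        using n norm_triangle_ineq4[of "f n - f m" "f n - f k"] by simp
    qed
    then show "\<exists>M. \<forall>m\<ge>M. \<forall>n>m. dist (f m) (f n) < \<delta>"
      by (auto simp: dist_norm)
  qed
  then obtain L where L: "f \<longlonglongrightarrow> L"
    using Cauchy_convergent convergent_def by blast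
  have "L \<le> d" if "d \<in> D" for d
  proof -
    \<comment> \<open>The members \<open>h n\<close> lie below \<open>d\<close> and within 1/(n+1)
      of \<open>f n\<close>, so they carry the limit \<open>L\<close> below
      \<open>d\<close>.\<close>
    have "\<forall>n. \<exists>h\<in>D. h \<le> d \<and> h \<le> f n"
      using D_directed[OF that f_D] by blast
    then obtain h where h: "\<And>n. h n \<in> D" "\<And>n. h n \<le> d" "\<And>n. h n \<le> f n"
      by metis
    have "(\<lambda>n. f n - h n) \<longlonglongrightarrow> 0"
      by (rule Lim_null_comparison[OF always_eventually inverse_null])
        (use f_close[OF h(1,3)] in \<open>blast intro: less_imp_le\<close>)
    then have "(\<lambda>n. f n - (f n - h n)) \<longlonglongrightarrow> L - 0"
      by (intro tendsto_diff L)
    then have "h \<longlonglongrightarrow> L"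
      by (simp only: diff_diff_eq2 add_diff_cancel_left' diff_0_right)
    then show ?thesis
      using h(2) by (rule tendsto_upperbound_banach_lattice)
  qed
  then have "L \<le> 0"
    by (rule D_inf)
  moreover have "- L \<le> 0"
    using D_nonneg[OF f_D] by (intro tendsto_upperbound_banach_lattice[OF tendsto_minus[OF L]]) simp
  ultimately have "f \<longlonglongrightarrow> 0"
    using L by simp
  then have "(\<lambda>n. norm (f n)) \<longlonglongrightarrow> 0"
    by (rule tendsto_norm_zero)
  then have "eventually (\<lambda>n. norm (f n) < \<epsilon>) sequentially"
    using \<epsilon> by (rule order_tendstoD(2))
  then show ?thesis
    using f_D unfolding eventually_sequentially by blast
qed

section \<open>The Banach space ell1\<close>

lemma ell1_simps [simp]:
  "vcarrier ell1 = {f. summable (\<lambda>n. \<bar>f n\<bar>)}" "vzero ell1 = (\<lambda>n. 0)"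
  "vadd ell1 f g = (\<lambda>n. f n + g n)" "vscale ell1 c f = (\<lambda>n. c * f n)"
  "vnorm ell1 f = (\<Sum>n. \<bar>f n\<bar>)"
  by (simp_all add: ell1_def)

lemma summable_abs_add:
  fixes f g :: "nat \<Rightarrow> real"
  assumes "summable (\<lambda>n. \<bar>f n\<bar>)" "summable (\<lambda>n. \<bar>g n\<bar>)"
  shows "summable (\<lambda>n. \<bar>f n + g n\<bar>)"
  by (rule summable_comparison_test'[OF summable_add[OF assms]]) (simp add: abs_triangle_ineq)

lemma summable_abs_mult:
  fixes f :: "nat \<Rightarrow> real"
  assumes "summable (\<lambda>n. \<bar>f n\<bar>)"
  shows "summable (\<lambda>n. \<bar>c * f n\<bar>)"
  using assms by (simp add: abs_mult summable_mult)

lemma summable_abs_diff: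
  fixes f g :: "nat \<Rightarrow> real"
  assumes "summable (\<lambda>n. \<bar>f n\<bar>)" "summable (\<lambda>n. \<bar>g n\<bar>)"
  shows "summable (\<lambda>n. \<bar>f n - g n\<bar>)"
  using summable_abs_add[of f "\<lambda>n. - g n"] assms by simp

lemma suminf_abs_triangle:
  fixes f g :: "nat \<Rightarrow> real"
  assumes "summable (\<lambda>n. \<bar>f n\<bar>)" "summable (\<lambda>n. \<bar>g n\<bar>)"
  shows "(\<Sum>n. \<bar>f n + g n\<bar>) \<le> (\<Sum>n. \<bar>f n\<bar>) + (\<Sum>n. \<bar>g n\<bar>)"
  unfolding suminf_add[OF assms]
  by (intro suminf_le summable_abs_add summable_add assms abs_triangle_ineq)

lemma vdist_ell1:
  assumes "summable (\<lambda>n. \<bar>f n\<bar>)" "summable (\<lambda>n. \<bar>g n\<bar>)"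
  shows "vdist ell1 f g = (\<Sum>n. \<bar>f n - g n\<bar>)"
  using assms by (simp add: vdist_def)

text \<open>Gives access to the metric notions behind \<open>mcomplete\<close>, here and when
  \<open>ell1\<close> is copied to another type.\<close>

lemma Metric_space_ell1: "Metric_space (vcarrier ell1) (vdist ell1)"
proof
  fix f g h :: "nat \<Rightarrow> real"
  show "0 \<le> vdist ell1 f g"
    by (cases "summable (\<lambda>n. \<bar>f n\<bar>) \<and> summable (\<lambda>n. \<bar>g n\<bar>)")
      (auto simp: vdist_ell1 vdist_def intro!: suminf_nonneg summable_abs_diff)
  show "vdist ell1 f g = vdist ell1 g f"
    by (simp add: vdist_def abs_minus_commute)
  assume "f \<in> vcarrier ell1" "g \<in> vcarrier ell1"
  then have fg: "summable (\<lambda>n. \<bar>f n\<bar>)" "summable (\<lambda>n. \<bar>g n\<bar>)"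
    by simp_all
  show "vdist ell1 f g = 0 \<longleftrightarrow> f = g"
    using suminf_eq_zero_iff[OF summable_abs_diff[OF fg]] by (auto simp: vdist_ell1 fg)
  assume "h \<in> vcarrier ell1"
  then have h: "summable (\<lambda>n. \<bar>h n\<bar>)"
    by simp
  show "vdist ell1 f h \<le> vdist ell1 f g + vdist ell1 g h"
    using suminf_abs_triangle[OF summable_abs_diff[OF fg] summable_abs_diff[OF fg(2) h]]
    by (simp add: vdist_ell1 fg h)
qed

text \<open>The limit is taken coordinatewise. Finite partial sums of the distances pass to the
  limit, and their uniform bound then controls the whole series.\<close>

lemma ell1_complete: "Metric_space.mcomplete (vcarrier ell1) (vdist ell1)"
proof -
  interpret Metric_space "vcarrier ell1" "vdist ell1"
    by (rule Metric_space_ell1)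
  show ?thesis
    unfolding mcomplete_def
  proof (intro allI impI)
    fix F assume F: "MCauchy F"
    have sF: "summable (\<lambda>n. \<bar>F k n\<bar>)" for k
    proof -
      have "F k \<in> vcarrier ell1"
        using F unfolding MCauchy_def by blast
      then show ?thesis
        by simp
    qed
    have dist: "vdist ell1 (F k) (F l) = (\<Sum>n. \<bar>F k n - F l n\<bar>)" for k l
      by (rule vdist_ell1[OF sF sF])
    have cauchy: "\<exists>N. \<forall>k\<ge>N. \<forall>l\<ge>N. (\<Sum>n. \<bar>F k n - F l n\<bar>) < \<epsilon>" if "\<epsilon> > 0" for \<epsilon>
    proof -
      have "\<forall>\<epsilon>>0. \<exists>N. \<forall>k l. N \<le> k \<longrightarrow> N \<le> l \<longrightarrow> vdist ell1 (F k) (F l) < \<epsilon>"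
        using F unfolding MCauchy_def by (rule conjunct2)
      then have "\<exists>N. \<forall>k l. N \<le> k \<longrightarrow> N \<le> l \<longrightarrow> vdist ell1 (F k) (F l) < \<epsilon>"
        using that by blast
      then show ?thesis
        unfolding dist by blast
    qed
    have partial: "(\<Sum>n<M. \<bar>F k n - F l n\<bar>) \<le> (\<Sum>n. \<bar>F k n - F l n\<bar>)" for k l M
      by (intro sum_le_suminf summable_abs_diff sF) auto
    have "Cauchy (\<lambda>k. F k n)" for n
    proof (rule metric_CauchyI)
      fix \<epsilon> :: real assume "\<epsilon> > 0"
      then obtain N where N: "\<forall>k\<ge>N. \<forall>l\<ge>N. (\<Sum>n. \<bar>F k n - F l n\<bar>) < \<epsilon>"
        using cauchy by blast
      have "dist (F k n) (F l n) < \<epsilon>" if "k \<ge> N" "l \<ge> N" for k l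
      proof -
        have "\<bar>F k n - F l n\<bar> \<le> (\<Sum>m<Suc n. \<bar>F k m - F l m\<bar>)"
          by (intro member_le_sum) auto
        also have "\<dots> \<le> (\<Sum>m. \<bar>F k m - F l m\<bar>)"
          by (rule partial)
        also have "\<dots> < \<epsilon>"
          using N that by blast
        finally show ?thesis
          by (simp add: dist_real_def)
      qed
      then show "\<exists>N. \<forall>k\<ge>N. \<forall>l\<ge>N. dist (F k n) (F l n) < \<epsilon>"
        by blast
    qed
    then have "\<forall>n. \<exists>a. (\<lambda>k. F k n) \<longlonglongrightarrow> a"
      using Cauchy_convergent unfolding convergent_def by blast
    then obtain f where f: "\<And>n. (\<lambda>k. F k n) \<longlonglongrightarrow> f n"
      by metis
    have limit: "\<exists>N. \<forall>k\<ge>N. summable (\<lambda>n. \<bar>F k n - f n\<bar>) \<and> (\<Sum>n. \<bar>F k n - f n\<bar>) \<le> \<epsilon>"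
      if pos: "\<epsilon> > 0" for \<epsilon>
    proof -
      obtain N where N: "\<forall>k\<ge>N. \<forall>l\<ge>N. (\<Sum>n. \<bar>F k n - F l n\<bar>) < \<epsilon>"
        using cauchy[OF pos] by blast
      \<comment> \<open>The length \<open>M\<close> stays fixed while \<open>l\<close> tends to
        infinity, so only finitely many coordinate limits are involved.\<close>
      have bound: "(\<Sum>n<M. \<bar>F k n - f n\<bar>) \<le> \<epsilon>" if "k \<ge> N" for k M
      proof (rule LIMSEQ_le_const2)
        show "(\<lambda>l. \<Sum>n<M. \<bar>F k n - F l n\<bar>) \<longlonglongrightarrow> (\<Sum>n<M. \<bar>F k n - f n\<bar>)"
          by (intro tendsto_intros f)
        have "(\<Sum>n<M. \<bar>F k n - F l n\<bar>) \<le> \<epsilon>" if "l \<ge> N" for l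
          using partial[of k l M] N \<open>k \<ge> N\<close> that by (meson less_imp_le order_trans)
        then show "\<exists>N. \<forall>l\<ge>N. (\<Sum>n<M. \<bar>F k n - F l n\<bar>) \<le> \<epsilon>"
          by blast
      qed
      \<comment> \<open>The shift to \<open>Suc _\<close> turns the half-open range of
        \<open>bound\<close> into the closed range expected by
        \<open>bounded_imp_summable\<close>.\<close>
      have "summable (\<lambda>n. \<bar>F k n - f n\<bar>)" if "k \<ge> N" for k
        using bound[OF that, of "Suc _"] unfolding lessThan_Suc_atMost
        by (intro bounded_imp_summable[of _ \<epsilon>]) simp_all
      then show ?thesis
        using bound by (intro exI[of _ N]) (auto intro: suminf_le_const)
    qed
    obtain k where k: "summable (\<lambda>n. \<bar>F k n - f n\<bar>)"
      using limit[of 1] by auto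
    \<comment> \<open>The limit is recovered as \<open>F k\<close> minus the summable difference
      \<open>F k - f\<close>.\<close>
    have sf: "summable (\<lambda>n. \<bar>f n\<bar>)"
      using summable_abs_diff[OF sF[of k] k] by simp
    have "limitin mtopology F f sequentially"
      unfolding limitin_metric_dist_null
    proof (intro conjI)
      show "f \<in> vcarrier ell1"
        using sf by simp
      show "\<forall>\<^sub>F k in sequentially. F k \<in> vcarrier ell1"
        using sF by simp
      show "(\<lambda>k. vdist ell1 (F k) f) \<longlonglongrightarrow> 0"
      proof (rule LIMSEQ_I)
        fix \<epsilon> :: real assume "\<epsilon> > 0"
        then obtain N where N: "\<forall>k\<ge>N. (\<Sum>n. \<bar>F k n - f n\<bar>) \<le> \<epsilon> / 2"
          using limit[of "\<epsilon> / 2"] by auto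
        have "norm (vdist ell1 (F k) f - 0) < \<epsilon>" if "k \<ge> N" for k
          using N that \<open>\<epsilon> > 0\<close> suminf_nonneg[OF summable_abs_diff[OF sF[of k] sf]]
          by (auto simp: vdist_ell1[OF sF sf] dest!: spec[of _ k])
        then show "\<exists>N. \<forall>k\<ge>N. norm (vdist ell1 (F k) f - 0) < \<epsilon>"
          by blast
      qed
    qed
    then show "\<exists>f. limitin mtopology F f sequentially"
      by blast
  qed
qed

lemma banach_space_on_ell1: "banach_space_on ell1"
proof
  fix f :: "nat \<Rightarrow> real" assume f: "f \<in> vcarrier ell1"
  then show "\<exists>g\<in>vcarrier ell1. vadd ell1 f g = vzero ell1"
    by (intro bexI[of _ "\<lambda>n. - f n"]) auto
  show "vnorm ell1 f = 0 \<longleftrightarrow> f = vzero ell1"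
    using f suminf_eq_zero_iff[of "\<lambda>n. \<bar>f n\<bar>"] by auto
  show "vnorm ell1 (vscale ell1 c f) = \<bar>c\<bar> * vnorm ell1 f" for c
    using f by (simp add: abs_mult suminf_mult)
qed (auto simp: summable_abs_add summable_abs_mult suminf_abs_triangle algebra_simps
    intro: ell1_complete[simplified])

section \<open>Transport of a normed structure along an injection\<close>

text \<open>Assertion (2) ranges over structures on one type \<open>'x\<close>. This isometric copy
  makes it applicable to a space such as \<open>ell1\<close> that lives on another type; for
  injective \<phi>, \<open>inv \<phi>\<close> undoes the renaming.\<close>

definition transport :: "('a \<Rightarrow> 'b) \<Rightarrow> 'a normed_structure \<Rightarrow> 'b normed_structure" where
  "transport \<phi> X = \<lparr> vcarrier = \<phi> ` vcarrier X,
     vzero = \<phi> (vzero X),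
     vadd = (\<lambda>a b. \<phi> (vadd X (inv \<phi> a) (inv \<phi> b))),
     vscale = (\<lambda>c a. \<phi> (vscale X c (inv \<phi> a))),
     vnorm = (\<lambda>a. vnorm X (inv \<phi> a)) \<rparr>"

lemma transport_simps:
  "vcarrier (transport \<phi> X) = \<phi> ` vcarrier X" "vzero (transport \<phi> X) = \<phi> (vzero X)"
  "vadd (transport \<phi> X) a b = \<phi> (vadd X (inv \<phi> a) (inv \<phi> b))"
  "vscale (transport \<phi> X) c a = \<phi> (vscale X c (inv \<phi> a))"
  "vnorm (transport \<phi> X) a = vnorm X (inv \<phi> a)"
  by (simp_all add: transport_def)

text \<open>A Cauchy sequence in the image is pulled back along the isometry, and the limit found
  there is pushed forward.\<close>

lemma mcomplete_image:
  assumes X: "Metric_space M d" "Metric_space.mcomplete M d"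
    and Y: "Metric_space (\<phi> ` M) e"
    and isometry: "\<And>x y. x \<in> M \<Longrightarrow> y \<in> M \<Longrightarrow> e (\<phi> x) (\<phi> y) = d x y"
  shows "Metric_space.mcomplete (\<phi> ` M) e"
proof -
  interpret X: Metric_space M d by fact
  interpret Y: Metric_space "\<phi> ` M" e by fact
  show ?thesis
    unfolding Y.mcomplete_def
  proof (intro allI impI)
    fix \<tau> assume \<tau>: "Y.MCauchy \<tau>"
    then have "range \<tau> \<subseteq> \<phi> ` M"
      by (simp add: Y.MCauchy_def)
    then have "\<forall>n. \<exists>x\<in>M. \<tau> n = \<phi> x"
      by blast
    then obtain \<sigma> where \<sigma>: "\<And>n. \<sigma> n \<in> M" "\<And>n. \<tau> n = \<phi> (\<sigma> n)"
      by metis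
    have "X.MCauchy \<sigma>"
      using \<tau> \<sigma>(1) by (auto simp: Y.MCauchy_def X.MCauchy_def \<sigma>(2) isometry)
    then obtain x where "limitin X.mtopology \<sigma> x sequentially"
      using X(2) X.mcomplete_def by blast
    then have "limitin Y.mtopology \<tau> (\<phi> x) sequentially"
      using \<sigma> by (auto simp: X.limitin_metric_dist_null Y.limitin_metric_dist_null isometry)
    then show "\<exists>y. limitin Y.mtopology \<tau> y sequentially" ..
  qed
qed

lemma banach_space_on_transport:
  assumes \<phi>: "inj \<phi>" and X: "banach_space_on X" and metric: "Metric_space (vcarrier X) (vdist X)"
  shows "banach_space_on (transport \<phi> X)"
proof -
  interpret banach_space_on X by fact
  interpret Metric_space "vcarrier X" "vdist X" by fact
  note [simp] = inv_f_f[OF \<phi>] inj_eq[OF \<phi>]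
  have vdist: "vdist (transport \<phi> X) (\<phi> x) (\<phi> y) = vdist X x y"
    if "x \<in> vcarrier X" "y \<in> vcarrier X" for x y
    using that by (simp add: vdist_def transport_simps)
  have "Metric_space (\<phi> ` vcarrier X) (vdist (transport \<phi> X))"
  proof
    fix a b c
    \<comment> \<open>The axioms for arbitrary points need a case split, because
      \<open>vdist\<close> is 0 by convention outside the carrier.\<close>
    show "0 \<le> vdist (transport \<phi> X) a b" "vdist (transport \<phi> X) a b = vdist (transport \<phi> X) b a"
      using vdist by (cases "a \<in> \<phi> ` vcarrier X \<and> b \<in> \<phi> ` vcarrier X";
          auto simp: commute transport_simps vdist_def[of "transport \<phi> X"])+
    assume "a \<in> \<phi> ` vcarrier X" "b \<in> \<phi> ` vcarrier X"
    then show "vdist (transport \<phi> X) a b = 0 \<longleftrightarrow> a = b"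
      by (auto simp: vdist)
    assume "c \<in> \<phi> ` vcarrier X"
    with \<open>a \<in> _\<close> \<open>b \<in> _\<close>
    show "vdist (transport \<phi> X) a c \<le> vdist (transport \<phi> X) a b + vdist (transport \<phi> X) b c"
      by (auto simp: vdist intro: triangle)
  qed
  then have "Metric_space.mcomplete (vcarrier (transport \<phi> X)) (vdist (transport \<phi> X))"
    unfolding transport_simps by (intro mcomplete_image[OF metric complete] vdist)
  moreover have "\<exists>b\<in>\<phi> ` vcarrier X. \<phi> (vadd X (inv \<phi> (\<phi> x)) (inv \<phi> b)) = \<phi> (vzero X)"
    if "x \<in> vcarrier X" for x
    using add_inverse[OF that] by auto
  ultimately show ?thesis
    by unfold_locales
      (auto simp: transport_simps zero_closed add_closed scale_closed add_assoc add_zero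
        scale_add_right scale_add_left scale_scale scale_one norm_eq_zero norm_triangle norm_scale
        intro: add_commute)
qed

lemma unit_ball_transport:
  assumes "inj \<phi>"
  shows "unit_ball (transport \<phi> X) = \<phi> ` unit_ball X"
  by (auto simp: unit_ball_def transport_simps inv_f_f[OF assms])

lemma operator_on_transport:
  assumes "inj \<phi>" "operator_on X T"
  shows "operator_on (transport \<phi> X) (T \<circ> inv \<phi>)"
  using assms(2) by (simp add: operator_on_def transport_simps inv_f_f[OF assms(1)])

text \<open>Strong order boundedness and L-weak compactness of an operator see only the image of the
  unit ball, so this equality transfers both.\<close>

lemma transport_image_unit_ball:
  assumes "inj \<phi>"
  shows "(T \<circ> inv \<phi>) ` unit_ball (transport \<phi> X) = T ` unit_ball X"
  by (simp add: unit_ball_transport[OF assms] image_image inv_f_f[OF assms])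

section \<open>Operators on ell1 given by order bounded sequences\<close>

lemma summable_norm_scaleR_bounded:
  fixes v :: "nat \<Rightarrow> 'e::real_normed_vector"
  assumes "summable (\<lambda>n. \<bar>f n\<bar>)" "\<And>n. norm (v n) \<le> K"
  shows "summable (\<lambda>n. norm (f n *\<^sub>R v n))"
proof (rule summable_comparison_test'[OF summable_mult2[OF assms(1), of K]])
  show "norm (norm (f n *\<^sub>R v n)) \<le> \<bar>f n\<bar> * K" for n
    using mult_left_mono[OF assms(2)[of n], of "\<bar>f n\<bar>"] by simp
qed

lemma operator_on_ell1_suminf:
  fixes v :: "nat \<Rightarrow> 'e::banach"
  assumes "\<And>n. norm (v n) \<le> K"
  shows "operator_on ell1 (\<lambda>f. \<Sum>n. f n *\<^sub>R v n)"
  unfolding operator_on_def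
proof (intro conjI)
  have nsm: "summable (\<lambda>n. norm (f n *\<^sub>R v n))" if "f \<in> vcarrier ell1" for f
    using that assms by (intro summable_norm_scaleR_bounded) simp_all
  have sm: "summable (\<lambda>n. f n *\<^sub>R v n)" if "f \<in> vcarrier ell1" for f
    using nsm[OF that] by (rule summable_norm_cancel)
  show "\<forall>f\<in>vcarrier ell1. \<forall>g\<in>vcarrier ell1.
      (\<Sum>n. vadd ell1 f g n *\<^sub>R v n) = (\<Sum>n. f n *\<^sub>R v n) + (\<Sum>n. g n *\<^sub>R v n)"
    using suminf_add[OF sm sm] by (simp add: scaleR_add_left)
  show "\<forall>c. \<forall>f\<in>vcarrier ell1. (\<Sum>n. vscale ell1 c f n *\<^sub>R v n) = c *\<^sub>R (\<Sum>n. f n *\<^sub>R v n)"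
    using suminf_scaleR_right[OF sm] by simp
  have "norm (\<Sum>n. f n *\<^sub>R v n) \<le> K * vnorm ell1 f" if f: "f \<in> vcarrier ell1" for f
  proof -
    have "norm (\<Sum>n. f n *\<^sub>R v n) \<le> (\<Sum>n. norm (f n *\<^sub>R v n))"
      by (rule summable_norm[OF nsm[OF f]])
    also have "\<dots> \<le> (\<Sum>n. K * \<bar>f n\<bar>)"
      using f assms by (intro suminf_le nsm summable_mult)
        (auto simp: mult.commute[of K] intro: mult_left_mono)
    finally show ?thesis
      using f by (simp add: suminf_mult)
  qed
  then show "\<exists>K. \<forall>f\<in>vcarrier ell1. norm (\<Sum>n. f n *\<^sub>R v n) \<le> K * vnorm ell1 f"
    by blast
qed

text \<open>A partial sum is at most the partial \<ell>1 norm of \<open>f\<close> times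
  \<open>u\<close>, hence at most \<open>u\<close>, and upper bounds survive limits.\<close>

lemma suminf_scaleR_le:
  fixes v :: "nat \<Rightarrow> 'e::banach_lattice"
  assumes v: "\<And>n. 0 \<le> v n" "\<And>n. v n \<le> u" and f: "f \<in> unit_ball ell1"
  shows "(\<Sum>n. f n *\<^sub>R v n) \<le> u"
proof -
  have u: "0 \<le> u"
    using v[of 0] by (rule order_trans)
  have f: "summable (\<lambda>n. \<bar>f n\<bar>)" "(\<Sum>n. \<bar>f n\<bar>) \<le> 1"
    using f by (simp_all add: unit_ball_def)
  have "norm (v n) \<le> norm u" for n
    using v by (rule norm_mono_nonneg)
  then have "summable (\<lambda>n. f n *\<^sub>R v n)"
    using f(1) by (intro summable_norm_cancel[OF summable_norm_scaleR_bounded])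
  then have "(\<lambda>N. \<Sum>n<N. f n *\<^sub>R v n) \<longlonglongrightarrow> (\<Sum>n. f n *\<^sub>R v n)"
    by (rule summable_LIMSEQ)
  then show ?thesis
  proof (rule tendsto_upperbound_banach_lattice)
    fix N
    have "f n *\<^sub>R v n \<le> \<bar>f n\<bar> *\<^sub>R u" for n
      using v[of n] by (intro order_trans[OF scaleR_right_mono scaleR_left_mono]) auto
    then have "(\<Sum>n<N. f n *\<^sub>R v n) \<le> (\<Sum>n<N. \<bar>f n\<bar>) *\<^sub>R u"
      unfolding scaleR_sum_left by (rule sum_mono)
    also have "\<dots> \<le> 1 *\<^sub>R u"
      using sum_le_suminf[OF f(1), of "{..<N}"] f(2) u by (intro scaleR_right_mono) auto
    finally show "(\<Sum>n<N. f n *\<^sub>R v n) \<le> u"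
      by simp
  qed
qed

lemma strong_order_bounded_ell1_suminf:
  fixes v :: "nat \<Rightarrow> 'e::banach_lattice"
  assumes v: "\<And>n. 0 \<le> v n" "\<And>n. v n \<le> u"
  shows "strong_order_bounded ell1 (\<lambda>f. \<Sum>n. f n *\<^sub>R v n)"
proof -
  have "(\<Sum>n. f n *\<^sub>R v n) \<in> {- u..u}" if f: "f \<in> unit_ball ell1" for f
  proof -
    have "norm (v n) \<le> norm u" for n
      using v by (rule norm_mono_nonneg)
    then have "summable (\<lambda>n. f n *\<^sub>R v n)"
      using f by (intro summable_norm_cancel[OF summable_norm_scaleR_bounded]) (auto simp: unit_ball_def)
    \<comment> \<open>The ball is symmetric, so the upper bound applied to \<open>- f\<close> yields
      the lower bound.\<close>
    moreover have "(\<lambda>n. - f n) \<in> unit_ball ell1"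
      using f by (simp add: unit_ball_def)
    then have "(\<Sum>n. (- f n) *\<^sub>R v n) \<le> u"
      by (rule suminf_scaleR_le[OF v])
    ultimately have "- (\<Sum>n. f n *\<^sub>R v n) \<le> u"
      by (simp add: suminf_minus)
    then have "- u \<le> (\<Sum>n. f n *\<^sub>R v n)"
      using minus_le_iff by blast
    with suminf_scaleR_le[OF v f] show ?thesis
      by simp
  qed
  then show ?thesis
    unfolding strong_order_bounded_def order_bounded_def by blast
qed

section \<open>The implications between the assertions\<close>

lemma order_continuous_norm_if_ell1:
  assumes ell1: "\<And>T :: (nat \<Rightarrow> real) \<Rightarrow> 'e::banach_lattice. operator_on ell1 T \<Longrightarrow> strong_order_bounded ell1 T
      \<Longrightarrow> L_weakly_compact_operator ell1 T"
  shows "order_continuous_norm TYPE('e)"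
  unfolding order_continuous_norm_iff
proof (intro allI impI)
  fix D :: "'e set" and \<epsilon> :: real
  assume "decreases_to_zero D" "0 < \<epsilon>"
  then show "\<exists>d\<in>D. norm d < \<epsilon>"
  proof (rule decreases_to_zero_small_norm[rotated])
    fix v :: "nat \<Rightarrow> 'e" and u
    assume disj: "disjoint_sequence v" and v: "\<And>n. 0 \<le> v n" "\<And>n. v n \<le> u"
    define T where "T f = (\<Sum>n. f n *\<^sub>R v n)" for f
    have "norm (v n) \<le> norm u" for n
      using v by (rule norm_mono_nonneg)
    then have "operator_on ell1 T"
      unfolding T_def by (rule operator_on_ell1_suminf)
    moreover have "strong_order_bounded ell1 T"
      unfolding T_def by (rule strong_order_bounded_ell1_suminf[OF v])
    ultimately have "L_weakly_compact (T ` unit_ball ell1)"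
      using ell1 unfolding L_weakly_compact_operator_def by blast
    moreover have "range v \<subseteq> solid hull (T ` unit_ball ell1)"
    proof (rule order_trans[OF image_subsetI hull_subset])
      fix n :: nat
      \<comment> \<open>The unit vector at \<open>n\<close> is mapped to \<open>v n\<close>, so the
        given disjoint sequence runs inside the image of the ball.\<close>
      define e where "e m = (if m = n then 1 else 0 :: real)" for m
      have "e sums 1" "(\<lambda>m. e m *\<^sub>R v m) sums v n"
        using sums_single[of n "\<lambda>_. 1 :: real"] sums_single[of n v]
        by (simp_all add: e_def[abs_def] if_distrib[of "\<lambda>c. c *\<^sub>R _"] cong: if_cong)
      moreover have "\<bar>e m\<bar> = e m" for m
        by (simp add: e_def)
      ultimately have "e \<in> unit_ball ell1" "T e = v n"
        by (simp_all add: unit_ball_def T_def sums_iff)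
      then show "v n \<in> T ` unit_ball ell1"
        by (metis imageI)
    qed
    ultimately show "(\<lambda>n. norm (v n)) \<longlonglongrightarrow> 0"
      using disj unfolding L_weakly_compact_def by blast
  qed
qed

lemma order_continuous_norm_imp_L_weakly_compact_operator:
  fixes T :: "'x \<Rightarrow> 'e::banach_lattice"
  assumes "order_continuous_norm TYPE('e)" "banach_space_on X" "strong_order_bounded X T"
  shows "L_weakly_compact_operator X T"
proof -
  interpret banach_space_on X by fact
  \<comment> \<open>L-weak compactness demands a nonempty set, which the zero vector
    provides.\<close>
  have "vzero X \<in> unit_ball X"
    using zero_closed norm_eq_zero[OF zero_closed] by (simp add: unit_ball_def)
  then show ?thesis
    using assms(1,3) unfolding L_weakly_compact_operator_def strong_order_bounded_def
    by (intro order_continuous_norm_imp_L_weakly_compact) auto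
qed

text \<open>The assumption \<open>universe\<close> makes \<open>'x\<close> large enough to carry a
  copy of \<open>ell1\<close>. The step from (2) back to (1) applies (2) to that copy and then
  argues as for (3).\<close>

theorem corollary2p4:
  assumes universe: "\<exists>f :: (nat \<Rightarrow> real) \<Rightarrow> 'x. inj f"
  shows
    "(order_continuous_norm TYPE('e::banach_lattice) \<longleftrightarrow>
        (\<forall>X :: 'x normed_structure. banach_space_on X \<longrightarrow>
           (\<forall>T :: 'x \<Rightarrow> 'e. operator_on X T \<and> strong_order_bounded X T
              \<longrightarrow> L_weakly_compact_operator X T)))
     \<and>
     (order_continuous_norm TYPE('e) \<longleftrightarrow>
        (\<forall>T :: (nat \<Rightarrow> real) \<Rightarrow> 'e. operator_on ell1 T \<and> strong_order_bounded ell1 T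
           \<longrightarrow> L_weakly_compact_operator ell1 T))"
proof (intro conjI iffI allI impI)
  fix X :: "'x normed_structure" and T :: "'x \<Rightarrow> 'e"
  assume "order_continuous_norm TYPE('e)" "banach_space_on X"
    "operator_on X T \<and> strong_order_bounded X T"
  then show "L_weakly_compact_operator X T"
    using order_continuous_norm_imp_L_weakly_compact_operator by blast
next
  fix T :: "(nat \<Rightarrow> real) \<Rightarrow> 'e"
  assume "order_continuous_norm TYPE('e)" "operator_on ell1 T \<and> strong_order_bounded ell1 T"
  then show "L_weakly_compact_operator ell1 T"
    using order_continuous_norm_imp_L_weakly_compact_operator banach_space_on_ell1 by blast
next
  assume "\<forall>T :: (nat \<Rightarrow> real) \<Rightarrow> 'e. operator_on ell1 T \<and> strong_order_bounded ell1 T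
    \<longrightarrow> L_weakly_compact_operator ell1 T"
  then show "order_continuous_norm TYPE('e)"
    by (intro order_continuous_norm_if_ell1) blast
next
  assume all: "\<forall>X :: 'x normed_structure. banach_space_on X \<longrightarrow>
    (\<forall>T :: 'x \<Rightarrow> 'e. operator_on X T \<and> strong_order_bounded X T \<longrightarrow> L_weakly_compact_operator X T)"
  obtain \<phi> :: "(nat \<Rightarrow> real) \<Rightarrow> 'x" where \<phi>: "inj \<phi>"
    using universe by blast
  show "order_continuous_norm TYPE('e)"
  proof (rule order_continuous_norm_if_ell1)
    fix T :: "(nat \<Rightarrow> real) \<Rightarrow> 'e"
    assume T: "operator_on ell1 T" "strong_order_bounded ell1 T"
    have "banach_space_on (transport \<phi> ell1)"
      by (rule banach_space_on_transport[OF \<phi> banach_space_on_ell1 Metric_space_ell1])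
    moreover have "operator_on (transport \<phi> ell1) (T \<circ> inv \<phi>)"
      by (rule operator_on_transport[OF \<phi> T(1)])
    moreover have "strong_order_bounded (transport \<phi> ell1) (T \<circ> inv \<phi>)"
      using T(2) by (simp only: strong_order_bounded_def transport_image_unit_ball[OF \<phi>])
    ultimately have "L_weakly_compact_operator (transport \<phi> ell1) (T \<circ> inv \<phi>)"
      using all by blast
    then show "L_weakly_compact_operator ell1 T"
      by (simp only: L_weakly_compact_operator_def transport_image_unit_ball[OF \<phi>])
  qed
qed

end
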